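(* Let $n\geq2$, let $H=\{x\in\mathbb{R}^{n+1}:\sum_{i=1}^{n+1}x_i=0\}$ (an $n$-dimensional space identified with $\mathbb{R}^n$), let $A_n=\mathbb{Z}^{n+1}\cap H$, and let $\mathcal{P}\subset H$ be the Voronoi region of the lattice $A_n$ in $H$. Then $m_1(\mathbb{R}^n,\Vert\cdot\Vert_{\mathcal{P}})=\frac{1}{2^n}$.
   Context: The Voronoi region of a lattice $\Lambda$ in a Euclidean space $E$ is $\{z\in E:\langle z-x,z-x\rangle\geq\langle z,z\rangle\ \forall x\in\Lambda\}$; it is a convex polytope symmetric about $0$. For such a polytope $\mathcal{P}$, $\Vert x\Vert_{\mathcal{P}}=\inf\{\lambda\geq0:x\in\lambda\mathcal{P}\}$. A set $A$ avoids distance $1$ if $\Vert x-y\Vert\neq1$ for all $x,y\in A$. The density of a measurable $A\subset\mathbb{R}^n$ is $\delta(A)=\limsup_{R\to\infty}\operatorname{Vol}(A\cap[-R,R]^n)/\operatorname{Vol}([-R,R]^n)$, and $m_1(\mathbb{R}^n,\Vert\cdot\Vert)$ is the supremum of $\delta(A)$ over measurable $A$ avoiding distance $1$. *)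

theory Defs
  imports "HOL-Analysis.Analysis"
begin

definition voronoi_region :: "'a::real_inner set \<Rightarrow> 'a set \<Rightarrow> 'a set" where
  "voronoi_region E L = {z \<in> E. \<forall>x\<in>L. inner (z - x) (z - x) \<ge> inner z z}"

definition poly_norm :: "'a::real_vector set \<Rightarrow> 'a \<Rightarrow> real" where
  "poly_norm P x = Inf {t::real. t \<ge> 0 \<and> x \<in> ((\<lambda>p. t *\<^sub>R p) ` P)}"

definition avoids_dist_one :: "('a::real_vector \<Rightarrow> real) \<Rightarrow> 'a set \<Rightarrow> bool" where
  "avoids_dist_one N A \<longleftrightarrow> (\<forall>x\<in>A. \<forall>y\<in>A. N (x - y) \<noteq> 1)"

definition cube :: "real \<Rightarrow> (real^'n) set" where
  "cube R = {x. \<forall>i. \<bar>x $ i\<bar> \<le> R}"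

definition upper_density :: "(real^'n) set \<Rightarrow> ereal" where
  "upper_density A = Limsup at_top
     (\<lambda>R::real. ereal (measure lebesgue (A \<inter> cube R) / measure lebesgue (cube R :: (real^'n) set)))"

definition m1 :: "(real^'n \<Rightarrow> real) \<Rightarrow> ereal" where
  "m1 N = Sup {upper_density A | A. A \<in> sets lebesgue \<and> avoids_dist_one N A}"

text \<open>The hyperplane H in R^(n+1) (index type 'n::finite option has n+1 elements) and the lattice A_n.\<close>
definition hyperplaneH :: "(real^('n::finite option)) set" where
  "hyperplaneH = {x. (\<Sum>i\<in>UNIV. x $ i) = 0}"

definition lattice_A :: "(real^('n::finite option)) set" where
  "lattice_A = {x. (\<forall>i. x $ i \<in> \<int>)} \<inter> hyperplaneH"

end

(* On H the norm of the Voronoi region of A_n is osc x = max x_i - min x_i. Write p for the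
   orthogonal projection of R^(n+1) onto H, and let u X = p(1_X) / 2 for a set X of coordinates.

   Upper bound: u X - u Y has norm 1 unless X and Y are comparable. If A avoids distance 1 and
   a is in A, the nonempty proper Y with a + u Y in A therefore form a chain and share a
   coordinate i(a). The sets a + {u X | i(a) not in X}, a in A, have 2^n elements each and are
   pairwise disjoint: if a + u X = b + u Y, then X and Y are comparable, and X < Y would give
   a = b + u (Y - X), so that i(b) lies in Y - X although i(b) is not in Y. Hence 2^n disjoint
   translates of pieces of A fit into a slightly larger cube.

   Lower bound: the open cells of norm radius 1/2 around the points of A_n avoid distance 1, since
   nonzero lattice vectors have norm at least 2. Up to a null set, the 2^n translates by
   representatives of (A_n / 2) / A_n cover the whole space. *)

theory Submission
  imports Defs "HOL-Real_Asymp.Real_Asymp"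
begin

section \<open>The norm of the Voronoi region on H\<close>

definition osc :: "real^'i \<Rightarrow> real" where
  "osc h = Max (range (\<lambda>(i, j). h $ i - h $ j))"

lemma osc_le_iff: "osc h \<le> t \<longleftrightarrow> (\<forall>i j. h $ i - h $ j \<le> t)"
  by (auto simp: osc_def)

lemma osc_less_iff: "osc h < t \<longleftrightarrow> (\<forall>i j. h $ i - h $ j < t)"
  by (auto simp: osc_def)

lemma osc_diff_le: "h $ i - h $ j \<le> osc h"
  using osc_le_iff by blast

lemma osc_nonneg: "0 \<le> osc h"
  using osc_diff_le[of h undefined undefined] by simp

lemma axis_diff_in_lattice: "axis i 1 - axis j 1 \<in> lattice_A"
  by (auto simp: lattice_A_def hyperplaneH_def sum_subtractf axis_def)

text \<open>The roots e_i - e_j, of squared length 2, already force every coordinate difference to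
  be at most 1. Conversely, once z is recentred to have coordinates in [-1/2, 1/2], the inequality
  2<z,x> <= <x,x> holds coordinatewise, because |k| <= k^2 for integers k.\<close>

lemma voronoi_region_lattice_A:
  "voronoi_region hyperplaneH lattice_A = {z \<in> hyperplaneH. osc z \<le> 1}"
proof -
  have expand: "inner z z \<le> inner (z - x) (z - x) \<longleftrightarrow> 2 * inner z x \<le> inner x x"
    for z x :: "real^('n::finite option)"
    by (simp add: inner_diff_left inner_diff_right inner_commute)
  have A: "osc z \<le> 1" if z: "\<forall>x\<in>lattice_A. inner z z \<le> inner (z - x) (z - x)"
    for z :: "real^('n::finite option)"
    unfolding osc_le_iff
  proof (intro allI)
    fix i j
    have "2 * inner z (axis i 1 - axis j 1)
        \<le> inner (axis i 1 - axis j 1) (axis i 1 - axis j 1 :: real^('n option))"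
      using z axis_diff_in_lattice[of i j] expand by blast
    also have "inner z (axis i 1 - axis j 1) = z $ i - z $ j"
      by (simp add: inner_diff_right inner_axis)
    finally show "z $ i - z $ j \<le> 1"
      by (cases "i = j") (simp_all add: inner_diff_left inner_diff_right inner_axis_axis)
  qed
  have B: "inner z z \<le> inner (z - x) (z - x)"
    if z: "osc z \<le> 1" and x: "x \<in> lattice_A" for z x :: "real^('n::finite option)"
  proof -
    define m where "m = Min (range (\<lambda>i. z $ i))"
    have m: "m \<le> z $ i" for i
      by (simp add: m_def)
    have "m \<in> range (\<lambda>i. z $ i)"
      unfolding m_def by (rule Min_in) auto
    then obtain j where j: "m = z $ j" by auto
    have w: "\<bar>z $ i - m - 1/2\<bar> \<le> 1/2" for i
      using m[of i] z[unfolded osc_le_iff, rule_format, of i j] j by linarith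
    have x0: "(\<Sum>i\<in>UNIV. x $ i) = 0" and xi: "x $ i \<in> \<int>" for i
      using x by (auto simp: lattice_A_def hyperplaneH_def)
    \<comment> \<open>Since x has coordinate sum 0, recentring z by the constant
      \<open>m + 1/2\<close> leaves the inner product unchanged.\<close>
    have "inner z x = (\<Sum>i\<in>UNIV. (z $ i - m - 1/2) * x $ i) + (m + 1/2) * (\<Sum>i\<in>UNIV. x $ i)"
      by (simp add: inner_vec_def sum_distrib_left flip: sum.distrib) (simp add: algebra_simps)
    also have "\<dots> = (\<Sum>i\<in>UNIV. (z $ i - m - 1/2) * x $ i)"
      by (simp add: x0)
    also have "\<dots> \<le> (\<Sum>i\<in>UNIV. 1/2 * (x $ i * x $ i))"
    proof (rule sum_mono)
      fix i
      have "(z $ i - m - 1/2) * x $ i \<le> \<bar>z $ i - m - 1/2\<bar> * \<bar>x $ i\<bar>"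
        by (metis abs_ge_self abs_mult)
      also have "\<dots> \<le> 1/2 * \<bar>x $ i\<bar>"
        by (intro mult_right_mono w) auto
      also have "\<bar>x $ i\<bar> \<le> \<bar>x $ i\<bar> * \<bar>x $ i\<bar>"
      proof (cases "x $ i = 0")
        case False
        then have "1 \<le> \<bar>x $ i\<bar>" using xi[of i] by (simp add: Ints_nonzero_abs_ge1)
        then show ?thesis using mult_right_mono[of 1 "\<bar>x $ i\<bar>" "\<bar>x $ i\<bar>"] by simp
      qed auto
      finally show "(z $ i - m - 1/2) * x $ i \<le> 1/2 * (x $ i * x $ i)" by simp
    qed
    also have "\<dots> = inner x x / 2"
      by (simp add: inner_vec_def sum_divide_distrib)
    finally show ?thesis unfolding expand by simp
  qed
  show ?thesis
    unfolding voronoi_region_def using A B by auto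
qed

text \<open>On the whole space \<open>osc\<close> is only a seminorm that vanishes on constant
  vectors; H contains no constant vector except 0.\<close>

lemma hyperplaneH_osc_le_0:
  assumes "h \<in> hyperplaneH" "osc h \<le> 0"
  shows "h = 0"
proof -
  have eq: "h $ i = h $ None" for i
    using assms(2) unfolding osc_le_iff by (metis eq_iff diff_le_0_iff_le)
  have "(\<Sum>i\<in>UNIV. h $ i) = (\<Sum>i\<in>(UNIV::'a option set). h $ None)"
    by (intro sum.cong refl eq)
  then have "h $ None = 0"
    using assms(1) by (simp add: hyperplaneH_def)
  then show ?thesis by (metis eq vec_eq_iff zero_index)
qed

text \<open>The admissible scaling factors form exactly the closed ray starting at
  \<open>osc h\<close>, so the infimum is attained there.\<close>

lemma poly_norm_voronoi_lattice_A:
  assumes h: "h \<in> hyperplaneH"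
  shows "poly_norm (voronoi_region hyperplaneH lattice_A) h = osc h"
proof -
  have "t \<ge> 0 \<and> h \<in> (\<lambda>p. t *\<^sub>R p) ` {z \<in> hyperplaneH. osc z \<le> 1} \<longleftrightarrow> osc h \<le> t" for t
  proof (cases "t > 0")
    case True
    have "osc h \<le> t" if "h = t *\<^sub>R p" "osc p \<le> 1" for p
      using that True unfolding osc_le_iff by (simp flip: right_diff_distrib)
    moreover have "h \<in> (\<lambda>p. t *\<^sub>R p) ` {z \<in> hyperplaneH. osc z \<le> 1}" if "osc h \<le> t"
    proof (rule image_eqI)
      show "h = t *\<^sub>R (h /\<^sub>R t)" using True by simp
      show "h /\<^sub>R t \<in> {z \<in> hyperplaneH. osc z \<le> 1}"
        using h that True
        by (auto simp: hyperplaneH_def osc_le_iff field_simps simp flip: sum_distrib_left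
            sum_divide_distrib)
    qed
    ultimately show ?thesis using True by auto
  next
    case False
    have "osc (0::real^'a option) \<le> 1" "(0::real^'a option) \<in> hyperplaneH" "osc (0::real^'a option) \<le> 0"
      by (auto simp: osc_le_iff hyperplaneH_def)
    then show ?thesis
      using False hyperplaneH_osc_le_0[OF h] osc_nonneg[of h]
      by (cases "t = 0") (auto intro!: image_eqI[of _ _ 0])
  qed
  then have "{t. t \<ge> 0 \<and> h \<in> (\<lambda>p. t *\<^sub>R p) ` {z \<in> hyperplaneH. osc z \<le> 1}} = {osc h..}"
    by auto
  then show ?thesis
    by (simp add: poly_norm_def voronoi_region_lattice_A)
qed

section \<open>Cubes and density estimates\<close>

lemma cube_eq_cbox: "cube R = cbox (\<chi> i. - R) (\<chi> i. R)"
  by (auto simp: cube_def mem_box_cart abs_le_iff minus_le_iff)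

lemma measure_cube: "R \<ge> 0 \<Longrightarrow> measure lebesgue (cube R :: (real^'n) set) = (2 * R) ^ CARD('n)"
  by (simp add: cube_eq_cbox content_cbox_if_cart interval_eq_empty_cart not_less)

lemma cube_add_mem: "x \<in> cube R \<Longrightarrow> norm v \<le> c \<Longrightarrow> x + v \<in> cube (R + c)"
  unfolding cube_def
proof safe
  fix i assume "\<forall>i. \<bar>x $ i\<bar> \<le> R" "norm v \<le> c"
  then have "\<bar>x $ i\<bar> \<le> R" "\<bar>v $ i\<bar> \<le> c"
    using component_le_norm_cart[of v i] by (auto intro: order_trans)
  then show "\<bar>(x + v) $ i\<bar> \<le> R + c" by simp
qed

lemma lmeasurable_Int_cube: "A \<in> sets lebesgue \<Longrightarrow> A \<inter> cube R \<in> lmeasurable"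
  unfolding cube_eq_cbox by (metis fmeasurable_Int_fmeasurable lmeasurable_cbox inf_commute)

text \<open>Packing estimate: intended for m disjoint translates of the part of A in a cube, by
  vectors of length at most c. Enlarging the cube by c costs the factor ((R + c) / R)^n, which tends
  to 1.\<close>

lemma upper_density_le:
  fixes A :: "(real^'n) set"
  assumes "m > 0" "c \<ge> 0"
    and bound: "\<And>R. R \<ge> 0 \<Longrightarrow> m * measure lebesgue (A \<inter> cube R) \<le> measure lebesgue (cube (R + c) :: (real^'n) set)"
  shows "upper_density A \<le> ereal (1 / m)"
proof -
  have "((\<lambda>R. ereal (((R + c) / R) ^ CARD('n) / m)) \<longlongrightarrow> ereal (1 ^ CARD('n) / m)) at_top"
    using \<open>m > 0\<close> by (intro tendsto_intros) (auto, real_asymp)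
  then have lim: "Limsup at_top (\<lambda>R. ereal (((R + c) / R) ^ CARD('n) / m)) = ereal (1 / m)"
    by (simp add: lim_imp_Limsup)
  show ?thesis
    unfolding upper_density_def lim[symmetric]
  proof (rule Limsup_mono, rule eventually_mono[OF eventually_gt_at_top[of 0]])
    fix R :: real assume "R > 0"
    then have "measure lebesgue (A \<inter> cube R) \<le> (2 * (R + c)) ^ CARD('n) / m"
      using bound[of R] assms by (simp add: measure_cube field_simps)
    then have "measure lebesgue (A \<inter> cube R) / measure lebesgue (cube R :: (real^'n) set)
       \<le> ((2 * (R + c)) ^ CARD('n) / m) / (2 * R) ^ CARD('n)"
      unfolding measure_cube[OF less_imp_le[OF \<open>R > 0\<close>]] by (rule divide_right_mono) (use \<open>R > 0\<close> in simp)
    also have "\<dots> = ((R + c) / R) ^ CARD('n) / m"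
      using \<open>R > 0\<close> unfolding power_divide power_mult_distrib by simp
    finally show "ereal (measure lebesgue (A \<inter> cube R) / measure lebesgue (cube R :: (real^'n) set))
         \<le> ereal (((R + c) / R) ^ CARD('n) / m)" by simp
  qed
qed

text \<open>Covering counterpart: intended for m translates of A that cover the cube up to a null
  set. The bound is applied at radius R - c, hence only for R > c.\<close>

lemma upper_density_ge:
  fixes A :: "(real^'n) set"
  assumes "m > 0" "c \<ge> 0"
    and bound: "\<And>R. R \<ge> 0 \<Longrightarrow> measure lebesgue (cube R :: (real^'n) set) \<le> m * measure lebesgue (A \<inter> cube (R + c))"
  shows "ereal (1 / m) \<le> upper_density A"
proof -
  have "((\<lambda>R. ereal (((R - c) / R) ^ CARD('n) / m)) \<longlongrightarrow> ereal (1 ^ CARD('n) / m)) at_top"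
    using \<open>m > 0\<close> by (intro tendsto_intros) (auto, real_asymp)
  then have lim: "Limsup at_top (\<lambda>R. ereal (((R - c) / R) ^ CARD('n) / m)) = ereal (1 / m)"
    by (simp add: lim_imp_Limsup)
  show ?thesis
    unfolding upper_density_def lim[symmetric]
  proof (rule Limsup_mono, rule eventually_mono[OF eventually_gt_at_top[of c]])
    fix R :: real assume "R > c"
    then have "R > 0" using \<open>c \<ge> 0\<close> by simp
    have "(2 * (R - c)) ^ CARD('n) / m \<le> measure lebesgue (A \<inter> cube R)"
      using bound[of "R - c"] assms \<open>R > c\<close> by (simp add: measure_cube field_simps)
    then have "((2 * (R - c)) ^ CARD('n) / m) / (2 * R) ^ CARD('n)
       \<le> measure lebesgue (A \<inter> cube R) / measure lebesgue (cube R :: (real^'n) set)"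
      unfolding measure_cube[OF less_imp_le[OF \<open>R > 0\<close>]] by (rule divide_right_mono) (use \<open>R > 0\<close> in simp)
    moreover have "((2 * (R - c)) ^ CARD('n) / m) / (2 * R) ^ CARD('n) = ((R - c) / R) ^ CARD('n) / m"
      using \<open>R > 0\<close> unfolding power_divide power_mult_distrib by simp
    ultimately show "ereal (((R - c) / R) ^ CARD('n) / m)
      \<le> ereal (measure lebesgue (A \<inter> cube R) / measure lebesgue (cube R :: (real^'n) set))" by simp
  qed
qed

section \<open>Upper bound: disjoint translates of pieces of A\<close>

text \<open>This is u X: subtracting the mean is the orthogonal projection onto H, and the factor
  1/2 gives incomparable sets distance exactly 1.\<close>

definition half_ind :: "'i::finite set \<Rightarrow> real^'i" where
  "half_ind X = (\<chi> i. indicator X i / 2 - real (card X) / (2 * CARD('i)))"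

lemma sum_indicator_UNIV: "(\<Sum>i\<in>(UNIV::'i::finite set). indicator X i) = real (card X)"
  by (simp add: indicator_def sum.If_cases)

lemma half_ind_in_hyperplaneH: "half_ind X \<in> hyperplaneH"
proof -
  have "(\<Sum>i\<in>UNIV. half_ind X $ i) = 0" for X :: "'i::finite set"
    by (simp add: half_ind_def sum_subtractf sum_indicator_UNIV flip: sum_divide_distrib)
  then show ?thesis
    by (simp add: hyperplaneH_def)
qed

lemma half_ind_diff:
  assumes "X \<subseteq> Y"
  shows "half_ind Y - half_ind X = half_ind (Y - X)"
proof -
  have "card (Y - X) = card Y - card X" "card X \<le> card Y"
    using assms by (auto simp: card_Diff_subset card_mono)
  then show ?thesis
    using assms
    by (auto simp: half_ind_def vec_eq_iff of_nat_diff diff_divide_distrib indicator_def)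
qed

text \<open>The subtracted means cancel in coordinate differences. What remains has entries -1/2, 0,
  1/2, and incomparability makes both extremes occur.\<close>

lemma osc_half_ind_diff:
  assumes "\<not> X \<subseteq> Y" "\<not> Y \<subseteq> X"
  shows "osc (half_ind X - half_ind Y) = 1"
proof (rule antisym)
  show "osc (half_ind X - half_ind Y) \<le> 1"
    by (auto simp: osc_le_iff half_ind_def indicator_def)
  obtain i j where "i \<in> X - Y" "j \<in> Y - X"
    using assms by blast
  then show "1 \<le> osc (half_ind X - half_ind Y)"
    using osc_diff_le[of "half_ind X - half_ind Y" i j] by (auto simp: half_ind_def)
qed

text \<open>A minimal member of a finite chain lies inside all the others, and it is
  nonempty.\<close>

lemma finite_chain_common_element:
  fixes C :: "'i::finite set set"
  assumes chain: "\<And>X Y. X \<in> C \<Longrightarrow> Y \<in> C \<Longrightarrow> X \<subseteq> Y \<or> Y \<subseteq> X" and "{} \<notin> C"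
  shows "\<exists>i. \<forall>X\<in>C. i \<in> X"
proof (cases "C = {}")
  case False
  then obtain M where M: "M \<in> C" "\<forall>X\<in>C. X \<subseteq> M \<longrightarrow> M = X"
    using finite_has_minimal[of C] by auto
  then obtain i where "i \<in> M"
    using assms(2) by fastforce
  then show ?thesis
    using M chain by blast
qed auto

text \<open>Only two properties of \<open>half_ind\<close> enter the packing argument, so it is
  carried out for an abstract family u in R^n; this allows pulling \<open>half_ind\<close> back
  along the identification with H.\<close>

lemma upper_density_avoiding_le:
  fixes A :: "(real^'n) set" and u :: "'i::finite set \<Rightarrow> real^'n"
  assumes A: "A \<in> sets lebesgue" and avoid: "avoids_dist_one N A"
    and u_diff: "\<And>X Y. X \<subseteq> Y \<Longrightarrow> u Y - u X = u (Y - X)"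
    and N_u: "\<And>X Y. \<not> X \<subseteq> Y \<Longrightarrow> \<not> Y \<subseteq> X \<Longrightarrow> N (u X - u Y) = 1"
  shows "upper_density A \<le> ereal (1 / 2 ^ (CARD('i) - 1))"
proof -
  define F where "F a = {Y. Y \<noteq> {} \<and> Y \<noteq> UNIV \<and> a + u Y \<in> A}" for a
  define g where "g f = (SOME i. \<forall>Y\<in>f. i \<in> Y)" for f :: "'i set set"
  \<comment> \<open>The omitted coordinate depends on the point a. Cutting A into the finitely many
    pieces on which \<open>F\<close> is constant makes it constant on each piece; \<open>J\<close>
    lists the pairs of a piece and an allowed translation.\<close>
  define P where "P f = {a \<in> A. F a = f}" for f
  define J where "J = (SIGMA f:UNIV. {X. g f \<notin> X})"
  define c where "c = Max (range (\<lambda>X. norm (u X)))"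
  have c: "norm (u X) \<le> c" for X
    by (simp add: c_def)
  then have "c \<ge> 0"
    using norm_ge_zero order_trans by blast
  have g: "g (F a) \<in> Z" if "Z \<in> F a" for a Z
  proof -
    have "X \<subseteq> Y \<or> Y \<subseteq> X" if "X \<in> F a" "Y \<in> F a" for X Y
      using that avoid N_u[of X Y] unfolding F_def avoids_dist_one_def
      by (metis (mono_tags, lifting) mem_Collect_eq add_diff_cancel_left)
    then have "\<exists>i. \<forall>Y\<in>F a. i \<in> Y"
      by (intro finite_chain_common_element) (auto simp: F_def)
    then have "\<forall>Y\<in>F a. g (F a) \<in> Y"
      unfolding g_def by (rule someI_ex)
    then show ?thesis
      using that by blast
  qed
  have no_sub: "X = Y"
    if "a \<in> A" "b \<in> A" "g (F b) \<notin> Y" "a + u X = b + u Y" "X \<subseteq> Y" for a b X Y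
  proof (rule ccontr)
    assume "X \<noteq> Y"
    have "a = b + u (Y - X)"
      using that u_diff[of X Y] by (simp add: algebra_simps)
    \<comment> \<open>The set \<open>Y - X\<close> is nonempty because X is a proper subset of Y,
      and it is not everything because Y misses \<open>g (F b)\<close>.\<close>
    then have "Y - X \<in> F b"
      using \<open>X \<noteq> Y\<close> that by (auto simp: F_def)
    then show False
      using g that by blast
  qed
  have same: "X = Y"
    if "a \<in> A" "b \<in> A" "g (F a) \<notin> X" "g (F b) \<notin> Y" and eq: "a + u X = b + u Y" for a b X Y
  proof -
    have "a - b = u Y - u X"
      using eq by (simp add: algebra_simps)
    \<comment> \<open>Incomparable sets would put the two points a, b of A at distance 1.\<close>
    then have "X \<subseteq> Y \<or> Y \<subseteq> X"
      using N_u[of Y X] avoid that by (metis avoids_dist_one_def)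
    then show ?thesis
      using that no_sub[of a b Y X] no_sub[of b a X Y] by auto
  qed
  have P_sets: "P f \<in> sets lebesgue" for f
  proof -
    \<comment> \<open>Each condition that Y belongs to \<open>F a\<close> describes either the empty
      set or a translate of A, and \<open>P f\<close> is a finite Boolean combination of these with
      A.\<close>
    define E where "E Y = {a. Y \<in> F a}" for Y
    have E: "E Y \<in> sets lebesgue" for Y
    proof (cases "Y = {} \<or> Y = UNIV")
      case True
      then have "E Y = {}"
        by (auto simp: E_def F_def)
      then show ?thesis by simp
    next
      case False
      then have "E Y = (+) (- u Y) ` A"
        by (force simp: E_def F_def image_iff algebra_simps)
      then show ?thesis
        using lebesgue_sets_translation[OF A, of "- u Y"] by simp
    qed
    have "a \<in> (\<Inter>Y. if Y \<in> f then E Y else - E Y) \<longleftrightarrow> (\<forall>Y. Y \<in> F a \<longleftrightarrow> Y \<in> f)" for a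
      unfolding INT_iff by (auto simp: E_def)
    then have "P f = A \<inter> (\<Inter>Y. if Y \<in> f then E Y else - E Y)"
      unfolding P_def by blast
    also have "\<dots> \<in> sets lebesgue"
      using E A by (intro sets.Int sets.finite_INT) (auto simp: Compl_in_sets_lebesgue)
    finally show ?thesis .
  qed
  define D where "D R = (\<lambda>(f, X). (+) (u X) ` (P f \<inter> cube R))" for R
  have lmeas: "D R j \<in> lmeasurable" for R j
    by (cases j) (simp add: D_def measurable_translation lmeasurable_Int_cube P_sets)
  have disj: "pairwise (\<lambda>p q. disjnt (D R p) (D R q)) J" for R
  proof (rule pairwiseI)
    fix p q assume pq: "p \<in> J" "q \<in> J" "p \<noteq> q"
    obtain f X h Y where [simp]: "p = (f, X)" "q = (h, Y)"
      by (metis surj_pair)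
    have "X = Y \<and> a = b" if "a \<in> P f" "b \<in> P h" "a + u X = b + u Y" for a b
      using same[of a b X Y] that pq by (auto simp: J_def P_def)
    then show "disjnt (D R p) (D R q)"
      using pq by (auto simp: disjnt_def D_def P_def add.commute)
  qed
  have "2 ^ (CARD('i) - 1) * measure lebesgue (A \<inter> cube R) \<le> measure lebesgue (cube (R + c) :: (real^'n) set)"
    if "R \<ge> 0" for R
  proof -
    have "{X. i \<notin> X} = Pow (UNIV - {i})" for i :: 'i
      by auto
    then have card: "card {X. i \<notin> X} = 2 ^ (CARD('i) - 1)" for i :: 'i
      by (simp add: card_Pow)
    have "A \<inter> cube R = (\<Union>f. P f \<inter> cube R)"
      by (auto simp: P_def)
    also have "measure lebesgue \<dots> = (\<Sum>f\<in>UNIV. measure lebesgue (P f \<inter> cube R))"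
      by (rule measure_UNION')
        (auto simp: lmeasurable_Int_cube P_sets pairwise_def disjnt_def, auto simp: P_def)
    finally have "2 ^ (CARD('i) - 1) * measure lebesgue (A \<inter> cube R)
        = (\<Sum>f\<in>UNIV. \<Sum>X | g f \<notin> X. measure lebesgue (P f \<inter> cube R))"
      by (simp add: sum_distrib_left card)
    also have "\<dots> = (\<Sum>j\<in>J. measure lebesgue (D R j))"
      unfolding J_def by (subst sum.Sigma) (auto simp: D_def measure_translation intro!: sum.cong)
    also have "\<dots> = measure lebesgue (\<Union>j\<in>J. D R j)"
      by (rule measure_UNION'[symmetric]) (auto simp: lmeas disj)
    also have "\<dots> \<le> measure lebesgue (cube (R + c) :: (real^'n) set)"
    proof (rule measure_mono_fmeasurable)
      show "(\<Union>j\<in>J. D R j) \<subseteq> cube (R + c)"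
        using cube_add_mem[OF _ c] by (auto simp: D_def add.commute)
      show "(\<Union>j\<in>J. D R j) \<in> sets lebesgue"
        using lmeas by (intro sets.finite_UN) (auto simp: fmeasurableD)
    qed (simp add: cube_eq_cbox)
    finally show ?thesis .
  qed
  then show ?thesis
    using \<open>c \<ge> 0\<close> by (intro upper_density_le) auto
qed

section \<open>Lower bound: nearest lattice points and cells of radius 1/2\<close>

text \<open>Round every coordinate down, then raise the coordinates with the largest fractional parts,
  as many as needed to restore the zero sum.\<close>

lemma exists_lattice_A_osc_le_1:
  fixes h :: "real^('n::finite option)"
  assumes h: "h \<in> hyperplaneH"
  shows "\<exists>l\<in>lattice_A. osc (h - l) \<le> 1"
proof -
  \<comment> \<open>The number of coordinates to raise equals the sum of the fractional parts; it is
    an integer because h has coordinate sum 0.\<close>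
  define k where "k = nat (- (\<Sum>i\<in>UNIV. \<lfloor>h $ i\<rfloor>))"
  have h0: "(\<Sum>i\<in>UNIV. h $ i) = 0"
    using h by (simp add: hyperplaneH_def)
  then have frac_sum: "(\<Sum>i\<in>UNIV. frac (h $ i)) = real_of_int (- (\<Sum>i\<in>UNIV. \<lfloor>h $ i\<rfloor>))"
    by (simp add: frac_def sum_subtractf)
  moreover have "0 \<le> (\<Sum>i\<in>UNIV. frac (h $ i))"
    by (simp add: sum_nonneg)
  ultimately have "0 \<le> - (\<Sum>i\<in>UNIV. \<lfloor>h $ i\<rfloor>)"
    by (simp only: of_int_0_le_iff)
  then have "real k = real_of_int (- (\<Sum>i\<in>UNIV. \<lfloor>h $ i\<rfloor>))"
    unfolding k_def by (rule of_nat_nat)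
  then have k: "real k = (\<Sum>i\<in>UNIV. frac (h $ i))"
    using frac_sum by simp
  also have "\<dots> \<le> (\<Sum>i\<in>(UNIV::'n option set). 1)"
    by (intro sum_mono) (simp add: frac_lt_1 less_imp_le)
  finally have "k \<le> card (UNIV::'n option set)"
    by simp
  then obtain S0 :: "'n option set" where "card S0 = k"
    by (metis obtain_subset_with_card_n)
  \<comment> \<open>Choosing the k largest fractional parts is expressed as maximising their sum
    over all k-element sets; an exchange of two elements then recovers the ordering.\<close>
  then obtain S :: "'n option set" where S: "card S = k"
    and S_max: "\<And>S'. card S' = k \<Longrightarrow> (\<Sum>i\<in>S'. frac (h $ i)) \<le> (\<Sum>i\<in>S. frac (h $ i))"
  proof -
    let ?V = "\<lambda>S. \<Sum>i\<in>S. frac (h $ i)"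
    have "Max (?V ` {S. card S = k}) \<in> ?V ` {S. card S = k}"
      using \<open>card S0 = k\<close> by (intro Max_in) auto
    then obtain S where "card S = k" "?V S = Max (?V ` {S. card S = k})"
      by auto
    then show thesis
      using that by simp
  qed
  have swap: "frac (h $ i) \<le> frac (h $ j)" if "i \<notin> S" "j \<in> S" for i j
  proof -
    have "card (insert i (S - {j})) = k"
      using that S by (simp add: card_Diff_singleton) (metis card_gt_0_iff Suc_pred empty_iff finite)
    from S_max[OF this] show ?thesis
      using that by (simp add: sum_diff1)
  qed
  define l where "l = (\<chi> i. of_int \<lfloor>h $ i\<rfloor> + (indicator S i :: real))"
  have "(\<Sum>i\<in>UNIV. l $ i) = 0"
    using k S frac_sum by (simp add: l_def sum.distrib sum_indicator_UNIV)
  then have "l \<in> lattice_A"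
    by (auto simp: lattice_A_def hyperplaneH_def l_def indicator_def)
  moreover have "osc (h - l) \<le> 1"
    unfolding osc_le_iff
  proof (intro allI)
    fix i j
    have "(h - l) $ m = frac (h $ m) - indicator S m" for m
      by (simp add: l_def frac_def)
    \<comment> \<open>The critical case is i outside S and j inside S, where the difference is 1
      plus a difference of fractional parts that \<open>swap\<close> makes nonpositive.\<close>
    then show "(h - l) $ i - (h - l) $ j \<le> 1"
      using swap[of i j] frac_ge_0[of "h $ i"] frac_ge_0[of "h $ j"]
        frac_lt_1[of "h $ i"] frac_lt_1[of "h $ j"]
      by (cases "i \<in> S"; cases "j \<in> S"; simp del: frac_ge_0; linarith)
  qed
  ultimately show ?thesis by blast
qed

text \<open>A nonzero integer vector with sum 0 has both a positive and a negative entry, hence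
  entries at least 1 and at most -1.\<close>

lemma lattice_A_nonzero:
  assumes "l \<in> lattice_A" "l \<noteq> 0"
  shows "2 \<le> osc l"
proof -
  have l: "l $ i \<in> \<int>" "(\<Sum>i\<in>UNIV. l $ i) = 0" for i
    using assms by (auto simp: lattice_A_def hyperplaneH_def)
  have "\<exists>i. 0 < l $ i"
  proof (rule ccontr)
    assume "\<nexists>i. 0 < l $ i"
    then have "\<forall>i\<in>UNIV. - l $ i = 0"
      using l(2) by (subst sum_nonneg_eq_0_iff[symmetric]) (auto simp: sum_negf not_less)
    then show False using assms(2) by (simp add: vec_eq_iff)
  qed
  moreover have "\<exists>j. l $ j < 0"
  proof (rule ccontr)
    assume "\<nexists>i. l $ i < 0"
    then have "\<forall>i\<in>UNIV. l $ i = 0"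
      using l(2) by (subst sum_nonneg_eq_0_iff[symmetric]) (auto simp: sum_negf not_less)
    then show False using assms(2) by (simp add: vec_eq_iff)
  qed
  ultimately obtain i j where "0 < l $ i" "l $ j < 0" by blast
  then have "1 \<le> l $ i" "l $ j \<le> - 1"
    using Ints_nonzero_abs_ge1[OF l(1), of i] Ints_nonzero_abs_ge1[OF l(1), of j] by auto
  then show ?thesis
    using osc_diff_le[of l i j] by simp
qed

lemma osc_add_le: "osc (x + y) \<le> osc x + osc y"
  unfolding osc_le_iff
proof (intro allI)
  fix i j show "(x + y) $ i - (x + y) $ j \<le> osc x + osc y"
    using osc_diff_le[of x i j] osc_diff_le[of y i j] by simp
qed

lemma osc_minus: "osc (- x) = osc x"
proof -
  have "osc (- x) \<le> osc x" for x :: "real^'a"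
    unfolding osc_le_iff using osc_diff_le[of x] by (auto simp: algebra_simps)
  from this[of x] this[of "- x"] show ?thesis by simp
qed

text \<open>Two points of one cell have distance below 1. For different cells the centres are at
  least 2 apart and the offsets together take away less than 1.\<close>

lemma avoids_dist_one_cells:
  "avoids_dist_one (\<lambda>x. osc (T x)) {x. \<exists>l\<in>lattice_A. osc (T x - l) < 1/2}"
  if "linear T" for T :: "real^'n \<Rightarrow> real^('n option)"
  unfolding avoids_dist_one_def
proof safe
  fix x y l m
  assume l: "l \<in> lattice_A" "osc (T x - l) < 1/2" and m: "m \<in> lattice_A" "osc (T y - m) < 1/2"
    and one: "osc (T (x - y)) = 1"
  define w where "w = (T x - l) + - (T y - m)"
  have w: "osc w < 1"
    using l m osc_add_le[of "T x - l" "- (T y - m)"] unfolding w_def osc_minus by simp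
  have Txy: "T (x - y) = w + (l - m)"
    by (simp add: w_def linear_diff[OF that])
  show False
  proof (cases "l = m")
    case False
    have "l - m \<in> lattice_A"
      using l m by (auto simp: lattice_A_def hyperplaneH_def sum_subtractf)
    with False have "2 \<le> osc (l - m)"
      by (intro lattice_A_nonzero) auto
    also have "\<dots> = osc (T (x - y) + - w)"
      by (simp add: Txy)
    also have "\<dots> \<le> osc (T (x - y)) + osc w"
      using osc_add_le[of _ "- w"] by (simp only: osc_minus)
    finally show False using w one by simp
  qed (use w one Txy in simp)
qed

section \<open>Lower bound: covering by translates of the cells\<close>

lemma sum_UNIV_option:
  "(\<Sum>i\<in>(UNIV::'n::finite option set). f i) = f None + (\<Sum>j\<in>UNIV. f (Some j))"
  by (simp add: UNIV_option_conv sum.reindex)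

lemma lattice_A_of_Some:
  assumes "x \<in> hyperplaneH" "\<And>j. x $ Some j \<in> \<int>"
  shows "x \<in> lattice_A"
proof -
  have "x $ None = - (\<Sum>j\<in>UNIV. x $ Some j)"
    using assms(1) by (simp add: hyperplaneH_def sum_UNIV_option)
  then have "x $ None \<in> \<int>"
    using assms(2) by (simp add: Ints_sum)
  then have "x $ i \<in> \<int>" for i
    using assms(2) by (cases i) auto
  then show ?thesis
    using assms(1) by (simp add: lattice_A_def)
qed

lemma hyperplaneH_scaleR: "x \<in> hyperplaneH \<Longrightarrow> c *\<^sub>R x \<in> hyperplaneH"
  by (simp add: hyperplaneH_def flip: sum_distrib_left)

lemma hyperplaneH_diff: "x \<in> hyperplaneH \<Longrightarrow> y \<in> hyperplaneH \<Longrightarrow> x - y \<in> hyperplaneH"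
  by (simp add: hyperplaneH_def sum_subtractf)

text \<open>Forgetting the coordinate \<open>None\<close> identifies A_n with Z^n. The 0/1 vectors
  represent Z^n modulo 2 Z^n, and the entry at \<open>None\<close> restores the zero sum.\<close>

definition lattice_rep :: "'n::finite set \<Rightarrow> real^('n option)" where
  "lattice_rep Y = (\<chi> i. case i of None \<Rightarrow> - real (card Y) | Some j \<Rightarrow> indicator Y j)"

lemma lattice_rep_in_hyperplaneH: "lattice_rep Y \<in> hyperplaneH"
  by (simp add: hyperplaneH_def sum_UNIV_option lattice_rep_def sum_indicator_UNIV)

lemma lattice_A_mod_double:
  assumes "l \<in> lattice_A"
  obtains Y where "(1/2) *\<^sub>R (l - lattice_rep Y) \<in> lattice_A"
proof
  define Y where "Y = {j. odd \<lfloor>l $ Some j\<rfloor>}"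
  show "(1/2) *\<^sub>R (l - lattice_rep Y) \<in> lattice_A"
  proof (rule lattice_A_of_Some)
    show "(1/2) *\<^sub>R (l - lattice_rep Y) \<in> hyperplaneH"
      using assms lattice_rep_in_hyperplaneH
      by (intro hyperplaneH_scaleR hyperplaneH_diff) (auto simp: lattice_A_def)
    fix j
    obtain z where z: "l $ Some j = of_int z"
      using assms by (auto simp: lattice_A_def elim: Ints_cases)
    \<comment> \<open>The indicator of \<open>Y\<close> is the parity of z, so subtracting it before
      halving gives the integer quotient.\<close>
    have "((1/2) *\<^sub>R (l - lattice_rep Y)) $ Some j = of_int (z div 2)"
      using z by (auto simp: lattice_rep_def Y_def indicator_def elim!: evenE oddE)
    then show "((1/2) *\<^sub>R (l - lattice_rep Y)) $ Some j \<in> \<int>"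
      by simp
  qed
qed

lemma upper_density_cells_ge:
  fixes T :: "real^'n \<Rightarrow> real^('n option)"
  assumes T: "linear T" "range T = hyperplaneH"
  defines "A \<equiv> {x. \<exists>l\<in>lattice_A. osc (T x - l) < 1/2}"
  shows "A \<in> sets lebesgue" "ereal (1 / 2 ^ CARD('n)) \<le> upper_density A"
proof -
  \<comment> \<open>Membership in a cell is a finite system of strict inequalities, so
    \<open>A\<close> is open.\<close>
  have "A = (\<Union>l\<in>lattice_A. \<Inter>i. \<Inter>j. {x. (T x - l) $ i - (T x - l) $ j < 1/2})"
    unfolding A_def osc_less_iff by blast
  moreover have "open \<dots>"
    using linear_continuous_on[of T UNIV] T(1)
    by (intro open_UN ballI open_INT open_Collect_less continuous_intros) (auto simp: linear_conv_bounded_linear)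
  ultimately have "open A" by simp
  then show A: "A \<in> sets lebesgue"
    by (simp add: borel_open sets_completionI_sets)
  define r where "r Y = inv T ((1/2) *\<^sub>R lattice_rep Y)" for Y
  have r: "T (r Y) = (1/2) *\<^sub>R lattice_rep Y" for Y
    unfolding r_def using T(2) hyperplaneH_scaleR[OF lattice_rep_in_hyperplaneH] by (intro f_inv_into_f) auto
  \<comment> \<open>These are the walls on which a weak cell inequality can be an equality; off them
    the closed cells may be replaced by open ones.\<close>
  define Z where "Z = (\<Union>(i, j)\<in>{(i, j). i \<noteq> j}. \<Union>k::int. {x. T x $ i - T x $ j = of_int k / 2})"
  have hyper: "negligible {x. T x $ i - T x $ j = b}" if "i \<noteq> j" for i j b
  proof -
    define f where "f x = T x $ i - T x $ j" for x
    have "linear f"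
      unfolding f_def using T(1) by (intro linearI) (auto simp: linear_add linear_cmul algebra_simps)
    then have f: "f x = inner (adjoint f 1) x" for x
      using adjoint_works[of f x 1] by (simp add: inner_commute)
    \<comment> \<open>The functional f is nonzero, since it takes the value 2 at the preimage of a
      root; its level sets are therefore null hyperplanes.\<close>
    have "axis i 1 - axis j 1 \<in> range T"
      using T(2) axis_diff_in_lattice[of i j] by (simp add: lattice_A_def)
    then obtain x where "T x = axis i 1 - axis j 1" by auto
    then have "f x = 2"
      using that by (simp add: f_def axis_def)
    then have "adjoint f 1 \<noteq> 0"
      using f[of x] by auto
    then show ?thesis
      using negligible_hyperplane[of "adjoint f 1" b] by (simp add: f f_def[symmetric])
  qed
  have "negligible (\<Union>k::int. {x. T x $ i - T x $ j = of_int k / 2})" if "i \<noteq> j" for i j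
    by (rule negligible_countable_Union) (auto simp del: divide_eq_eq_numeral1 eq_divide_eq_numeral1 intro: hyper[OF that])
  then have Z: "negligible Z"
    unfolding Z_def by (intro negligible_countable_Union) auto
  define c where "c = Max (range (\<lambda>Y. norm (r Y)))"
  have c: "norm (- r Y) \<le> c" for Y
    by (simp add: c_def)
  then have "c \<ge> 0"
    using norm_ge_zero order_trans by blast
  have cover: "\<exists>Y. x - r Y \<in> A" if "x \<notin> Z" for x
  proof -
    \<comment> \<open>Rounding the doubled point to A_n and halving yields a point of A_n / 2 at
      distance at most 1/2.\<close>
    have "2 *\<^sub>R T x \<in> hyperplaneH"
      using T(2) by (intro hyperplaneH_scaleR) auto
    then obtain l where l: "l \<in> lattice_A" "osc (2 *\<^sub>R T x - l) \<le> 1"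
      using exists_lattice_A_osc_le_1 by blast
    obtain Y where Y: "(1/2) *\<^sub>R (l - lattice_rep Y) \<in> lattice_A"
      using lattice_A_mod_double[OF l(1)] .
    have "osc (T x - (1/2) *\<^sub>R l) < 1/2"
      unfolding osc_less_iff
    proof (intro allI)
      fix i j
      show "(T x - (1/2) *\<^sub>R l) $ i - (T x - (1/2) *\<^sub>R l) $ j < 1/2"
      proof (cases "i = j")
        case False
        have "l $ i - l $ j + 1 \<in> \<int>"
          using l(1) by (auto simp: lattice_A_def)
        then obtain k where "l $ i - l $ j + 1 = of_int k"
          by (elim Ints_cases)
        \<comment> \<open>Equality in the cell inequality would be a half-integer value of the
          coordinate difference, placing x on a wall.\<close>
        then have "T x $ i - T x $ j \<noteq> (l $ i - l $ j + 1) / 2"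
          using \<open>x \<notin> Z\<close> False by (auto simp: Z_def)
        moreover have "2 * (T x $ i) - l $ i - (2 * (T x $ j) - l $ j) \<le> 1"
          using osc_le_iff[THEN iffD1, OF l(2)] by simp
        ultimately show ?thesis by (simp add: field_simps)
      qed simp
    qed
    \<comment> \<open>Translation by \<open>r Y\<close> moves the chosen point of A_n / 2 into A_n
      itself.\<close>
    moreover have "T x - (1/2) *\<^sub>R l = T (x - r Y) - (1/2) *\<^sub>R (l - lattice_rep Y)"
      by (simp add: linear_diff[OF T(1)] r algebra_simps)
    ultimately have "x - r Y \<in> A"
      using Y unfolding A_def by auto
    then show ?thesis ..
  qed
  have "measure lebesgue (cube R :: (real^'n) set) \<le> 2 ^ CARD('n) * measure lebesgue (A \<inter> cube (R + c))"
    if "R \<ge> 0" for R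
  proof -
    let ?B = "\<lambda>Y. (+) (r Y) ` (A \<inter> cube (R + c))"
    have B: "?B Y \<in> lmeasurable" for Y
      by (intro measurable_translation lmeasurable_Int_cube A)
    have "cube R \<subseteq> Z \<union> (\<Union>Y. ?B Y)"
    proof
      fix x :: "real^'n" assume x: "x \<in> cube R"
      show "x \<in> Z \<union> (\<Union>Y. ?B Y)"
      proof (cases "x \<in> Z")
        case False
        then obtain Y where "x - r Y \<in> A" using cover by blast
        then have "x \<in> ?B Y"
          using cube_add_mem[OF x c[of Y]] by (intro image_eqI[of _ _ "x - r Y"]) auto
        then show ?thesis by blast
      qed simp
    qed
    then have "measure lebesgue (cube R :: (real^'n) set) \<le> measure lebesgue (Z \<union> (\<Union>Y. ?B Y))"
      using Z B by (intro measure_mono_fmeasurable)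
        (auto simp: cube_eq_cbox negligible_iff_measure intro!: fmeasurable.Un fmeasurable.finite_UN)
    also have "\<dots> \<le> measure lebesgue Z + measure lebesgue (\<Union>Y. ?B Y)"
      using Z B by (intro measure_Un_le sets.finite_UN) (auto simp: negligible_iff_measure fmeasurableD)
    also have "\<dots> \<le> 0 + (\<Sum>Y\<in>UNIV. measure lebesgue (?B Y))"
      using Z B by (intro add_mono measure_UNION_le) (auto simp: negligible_iff_measure fmeasurableD)
    also have "\<dots> = 2 ^ CARD('n) * measure lebesgue (A \<inter> cube (R + c))"
      using card_Pow[of "UNIV :: 'n set"] by (simp add: measure_translation)
    finally show ?thesis .
  qed
  then show "ereal (1 / 2 ^ CARD('n)) \<le> upper_density A"
    using \<open>c \<ge> 0\<close> by (intro upper_density_ge) auto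
qed

text \<open>The map \<open>T\<close> ranges over all linear identifications of R^n with H, so the
  value does not depend on the coordinates used for the density.\<close>

theorem theorem4:
  fixes T :: "real^'n \<Rightarrow> real^('n option)"
  assumes "CARD('n) \<ge> 2"
    and "linear T" and "inj T" and "range T = (hyperplaneH :: (real^('n option)) set)"
  shows "m1 (\<lambda>x. poly_norm (voronoi_region hyperplaneH lattice_A) (T x))
           = ereal (1 / 2 ^ CARD('n))"
proof -
  have N: "poly_norm (voronoi_region hyperplaneH lattice_A) (T x) = osc (T x)" for x
    using assms(4) by (intro poly_norm_voronoi_lattice_A) auto
  define u where "u X = inv T (half_ind X)" for X :: "'n option set"
  have Tu: "T (u X) = half_ind X" for X
    unfolding u_def using assms(4) half_ind_in_hyperplaneH by (intro f_inv_into_f) auto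
  have "u Y - u X = u (Y - X)" if "X \<subseteq> Y" for X Y
    using half_ind_diff[OF that] assms(3) by (intro injD[OF assms(3)]) (simp add: linear_diff[OF assms(2)] Tu)
  moreover have "osc (T (u X - u Y)) = 1" if "\<not> X \<subseteq> Y" "\<not> Y \<subseteq> X" for X Y
    using osc_half_ind_diff[OF that] by (simp add: linear_diff[OF assms(2)] Tu)
  ultimately have "upper_density A \<le> ereal (1 / 2 ^ CARD('n))"
    if "A \<in> sets lebesgue" "avoids_dist_one (\<lambda>x. osc (T x)) A" for A
    \<comment> \<open>The subsets live in an index type with n + 1 elements, so the exponent
      \<open>CARD('i) - 1\<close> becomes n.\<close>
    using upper_density_avoiding_le[OF that, of u] by simp
  then show ?thesis
    unfolding m1_def N
    \<comment> \<open>The supremum is attained by the union of the open cells.\<close>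
    using upper_density_cells_ge[OF assms(2,4)] avoids_dist_one_cells[OF assms(2)]
    by (intro antisym Sup_least order_trans[OF _ Sup_upper]) auto
qed

end
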